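(* Let $d\ge 2$ be a constant. There is a randomized algorithm which, given the vertex set $U(\mathcal{H})$ of a $d$-uniform hypergraph $\mathcal{H}$ (whose hyperedges are unknown), a positive integer $k$, and access to a GPISE oracle for $\mathcal{H}$, makes $\mathcal{O}(k^{2d}\log k)$ GPISE queries and, with probability at least $1-1/k^{c}$ for some constant $c>0$, solves $d$-Packing: it outputs a set of at least $k$ pairwise vertex-disjoint hyperedges of $\mathcal{H}$ if such a set exists, and otherwise reports that no such set exists.
   Context: A $d$-uniform hypergraph $\mathcal{H}$ has vertex set $U(\mathcal{H})$ and hyperedge set $\mathcal{F}(\mathcal{H})$, each hyperedge being a $d$-element subset of $U(\mathcal{H})$. The GPISE (generalized $d$-partite independent set edge) oracle takes as input $d$ pairwise disjoint non-empty subsets $A_1,\dots,A_d\subseteq U(\mathcal{H})$ and returns some hyperedge $\{u_1,\dots,u_d\}\in\mathcal{F}(\mathcal{H})$ with $u_i\in A_i$ for every $i\in[d]$ if one exists (an arbitrary such hyperedge), and returns NULL otherwise. The algorithm only counts oracle queries; running time is not bounded. *)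

theory Defs
  imports "HOL-Probability.Probability" "HOL-Library.Landau_Symbols"
begin

definition uniform_hypergraph :: "nat \<Rightarrow> 'a set \<Rightarrow> 'a set set \<Rightarrow> bool" where
  "uniform_hypergraph d U F \<longleftrightarrow> finite U \<and> (\<forall>e\<in>F. e \<subseteq> U \<and> card e = d)"

definition is_packing :: "'a set set \<Rightarrow> nat \<Rightarrow> 'a set set \<Rightarrow> bool" where
  "is_packing F k M \<longleftrightarrow> M \<subseteq> F \<and> finite M \<and> card M \<ge> k \<and> pairwise disjnt M"

text \<open>The output \<open>None\<close> is the report that no packing of size at least \<open>k\<close> exists.\<close>

definition solves_packing :: "'a set set \<Rightarrow> nat \<Rightarrow> 'a set set option \<Rightarrow> bool" where
  "solves_packing F k out \<longleftrightarrow>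
     (if \<exists>M. is_packing F k M then \<exists>M. out = Some M \<and> is_packing F k M else out = None)"

definition gpise_query :: "nat \<Rightarrow> 'a set \<Rightarrow> 'a set list \<Rightarrow> bool" where
  "gpise_query d U As \<longleftrightarrow> length As = d \<and>
     (\<forall>i<d. As ! i \<noteq> {} \<and> As ! i \<subseteq> U) \<and>
     (\<forall>i<d. \<forall>j<d. i \<noteq> j \<longrightarrow> As ! i \<inter> As ! j = {})"

definition crosses :: "'a set \<Rightarrow> 'a set list \<Rightarrow> bool" where
  "crosses e As \<longleftrightarrow>
     (\<exists>us. length us = length As \<and> e = set us \<and> (\<forall>i<length As. us ! i \<in> As ! i))"

text \<open>
  An oracle is a function of the transcript of earlier queries and answers and of the current
  query, so asking the same query twice may return two different hyperedges.
  Its answers to ill-formed queries are unconstrained.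
\<close>

definition gpise_oracle ::
    "nat \<Rightarrow> 'a set \<Rightarrow> 'a set set \<Rightarrow>
     (('a set list \<times> 'a set option) list \<Rightarrow> 'a set list \<Rightarrow> 'a set option) \<Rightarrow> bool" where
  "gpise_oracle d U F orc \<longleftrightarrow>
     (\<forall>tr As. gpise_query d U As \<longrightarrow>
        (case orc tr As of
           Some e \<Rightarrow> e \<in> F \<and> crosses e As
         | None \<Rightarrow> \<not> (\<exists>e\<in>F. crosses e As)))"

text \<open>
  Randomized adaptive query algorithms, with queries in \<open>'q\<close>, answers in \<open>'r\<close> and outputs in \<open>'o\<close>.
  \<open>Uniform n f\<close> draws \<open>i\<close> uniformly from \<open>{0, \<dots>, n}\<close> and continues as \<open>f i\<close>.
  Computation between queries is unrestricted, and every computation path is finite.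
\<close>

datatype ('q, 'r, 'o) rand_alg =
    Return 'o
  | Uniform nat "nat \<Rightarrow> ('q, 'r, 'o) rand_alg"
  | Query 'q "'r \<Rightarrow> ('q, 'r, 'o) rand_alg"

text \<open>The joint distribution of the output and the transcript, extending the transcript \<open>tr\<close>.\<close>

primrec run :: "(('q \<times> 'r) list \<Rightarrow> 'q \<Rightarrow> 'r) \<Rightarrow> ('q, 'r, 'o) rand_alg \<Rightarrow>
    ('q \<times> 'r) list \<Rightarrow> ('o \<times> ('q \<times> 'r) list) pmf" where
  "run orc (Return x) tr = return_pmf (x, tr)"
| "run orc (Uniform n f) tr = bind_pmf (pmf_of_set {0..n}) (\<lambda>i. run orc (f i) tr)"
| "run orc (Query Q f) tr = run orc (f (orc tr Q)) (tr @ [(Q, orc tr Q)])"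

end

theory Submission imports Defs
begin

text \<open>
  Colour the vertices uniformly at random with \<open>m = 2 (d k)\<^sup>2\<close> colours and put one query for each
  \<open>d\<close>-tuple of distinct non-empty colour classes. A packing of \<open>k\<close> hyperedges covers at most \<open>d k\<close>
  vertices, so with probability at least \<open>1/2\<close> all of these receive distinct colours. In that case
  every answer to the query with the colours of a hyperedge \<open>e\<close> of the packing has the same colour
  set as \<open>e\<close>. These colour sets are pairwise disjoint, hence so are the answers, whichever hyperedges
  the oracle picks. Since a round succeeds with probability \<open>1/2\<close> whatever happened before,
  \<open>\<lceil>log\<^sub>2 k\<rceil>\<close> rounds fail with probability at most \<open>1/k\<close>.
\<close>

section \<open>The randomized query algorithm\<close>

text \<open>The filter discards tuples with a repeated colour or an empty class: these are
  ill-formed queries, on which the oracle promises nothing.\<close>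

definition color_queries :: "nat \<Rightarrow> nat \<Rightarrow> 'a set \<Rightarrow> ('a \<Rightarrow> nat) \<Rightarrow> 'a set list list" where
  "color_queries d m U \<kappa> =
     filter (gpise_query d U) (map (map (\<lambda>c. {u \<in> U. \<kappa> u = c})) (List.n_lists d [0..<m]))"

text \<open>Continuation-passing form, as \<open>rand_alg\<close> comes without a bind;
  \<open>X\<close> accumulates the hyperedges returned so far.\<close>

primrec query_all :: "'q list \<Rightarrow> 'b set \<Rightarrow> ('b set \<Rightarrow> ('q, 'b option, 'o) rand_alg)
    \<Rightarrow> ('q, 'b option, 'o) rand_alg" where
  "query_all [] X g = g X"
| "query_all (Q # Qs) X g = Query Q (\<lambda>r. query_all Qs (X \<union> set_option r) g)"

text \<open>Exhaustive search, which is free since only queries are counted.\<close>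

definition extract_packing :: "nat \<Rightarrow> 'a set set \<Rightarrow> 'a set set option" where
  "extract_packing k X =
     (if \<exists>M. is_packing X k M then Some (SOME M. is_packing X k M) else None)"

definition colorings :: "nat \<Rightarrow> 'a set \<Rightarrow> ('a \<Rightarrow> nat) set" where
  "colorings m U = U \<rightarrow>\<^sub>E {..<m}"

text \<open>\<open>Uniform n\<close> draws from {0, ..., n}, hence the \<open>- 1\<close>; the index
  drawn is decoded into a colouring. Answers of all rounds are pooled in \<open>X\<close>, so one
  lucky round suffices.\<close>

primrec packing_rounds :: "nat \<Rightarrow> nat \<Rightarrow> nat \<Rightarrow> 'a set \<Rightarrow> nat \<Rightarrow> 'a set set
    \<Rightarrow> ('a set list, 'a set option, 'a set set option) rand_alg" where
  "packing_rounds d m k U 0 X = Return (extract_packing k X)"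
| "packing_rounds d m k U (Suc t) X =
     Uniform (card (colorings m U) - 1) (\<lambda>i.
       query_all (color_queries d m U (from_nat_into (colorings m U) i)) X
         (packing_rounds d m k U t))"


section \<open>Random colourings\<close>

lemma finite_colorings: "finite U \<Longrightarrow> finite (colorings m U)"
  by (simp add: colorings_def finite_PiE)

lemma colorings_nonempty: "m > 0 \<Longrightarrow> colorings m U \<noteq> {}"
  by (auto simp: colorings_def PiE_eq_empty_iff)

lemma map_from_nat_into_pmf_of_set:
  assumes "finite S" "S \<noteq> {}"
  shows "map_pmf (from_nat_into S) (pmf_of_set {0..card S - 1}) = pmf_of_set S"
proof -
  have "card S > 0"
    using assms by (simp add: card_gt_0_iff)
  then have "{0..card S - 1} = {..<card S}"
    by auto
  then show ?thesis
    using assms bij_betw_from_nat_into_finite[of S]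
    by (auto intro!: map_pmf_of_set_bij_betw simp: lessThan_empty_iff)
qed

text \<open>A colouring with equal colours at \<open>x\<close> and \<open>y\<close> is determined by
  its restriction to \<open>U - {x}\<close>, and \<open>U\<close> has \<open>m\<close> times as many
  colourings as \<open>U - {x}\<close>.\<close>

lemma card_colorings_collision:
  assumes "finite U" "x \<in> U" "y \<in> U" "x \<noteq> y"
  shows "m * card {\<kappa> \<in> colorings m U. \<kappa> x = \<kappa> y} \<le> card (colorings m U)"
proof -
  define V where "V = U - {x}"
  have U: "U = insert x V" and V: "x \<notin> V" "y \<in> V" "finite V"
    using assms by (auto simp: V_def)
  have "{\<kappa> \<in> colorings m U. \<kappa> x = \<kappa> y} \<subseteq> (\<lambda>g. g(x := g y)) ` colorings m V"
  proof
    fix \<kappa> assume \<kappa>: "\<kappa> \<in> {\<kappa> \<in> colorings m U. \<kappa> x = \<kappa> y}"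
    have "restrict \<kappa> V \<in> colorings m V"
      using \<kappa> by (auto simp: colorings_def U)
    moreover have "\<kappa> = (restrict \<kappa> V)(x := restrict \<kappa> V y)"
      using \<kappa> V by (auto simp: colorings_def U fun_eq_iff PiE_def extensional_def)
    ultimately show "\<kappa> \<in> (\<lambda>g. g(x := g y)) ` colorings m V"
      by blast
  qed
  then have "card {\<kappa> \<in> colorings m U. \<kappa> x = \<kappa> y} \<le> card (colorings m V)"
    by (rule surj_card_le[OF finite_colorings[OF V(3)]])
  moreover have "card (colorings m U) = m * card (colorings m V)"
    using V by (simp add: U colorings_def card_PiE)
  ultimately show ?thesis
    by simp
qed

text \<open>Union bound over the ordered pairs of distinct points of \<open>W\<close>, each of which
  collides with probability at most \<open>1 / m\<close>.\<close>

lemma prob_coloring_not_inj: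
  assumes "finite U" "W \<subseteq> U" "m > 0"
  shows "measure_pmf.prob (pmf_of_set (colorings m U)) {\<kappa>. \<not> inj_on \<kappa> W} \<le> (card W)\<^sup>2 / m"
proof -
  let ?C = "colorings m U"
  let ?D = "{(x, y). x \<in> W \<and> y \<in> W \<and> x \<noteq> y}"
  have W: "finite W"
    using assms finite_subset by blast
  have D: "?D \<subseteq> W \<times> W"
    by auto
  then have finD: "finite ?D"
    using W by (meson finite_SigmaI finite_subset)
  have pair: "measure_pmf.prob (pmf_of_set ?C) {\<kappa>. \<kappa> (fst p) = \<kappa> (snd p)} \<le> 1 / m"
    if "p \<in> ?D" for p
  proof -
    have "fst p \<in> U" "snd p \<in> U" "fst p \<noteq> snd p"
      using that assms(2) by auto
    then have "m * card (?C \<inter> {\<kappa>. \<kappa> (fst p) = \<kappa> (snd p)}) \<le> card ?C"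
      using card_colorings_collision[OF assms(1)] by (simp add: Int_def)
    then have "real m * real (card (?C \<inter> {\<kappa>. \<kappa> (fst p) = \<kappa> (snd p)})) \<le> real (card ?C)"
      unfolding of_nat_mult[symmetric] by (rule of_nat_mono)
    moreover have "card ?C > 0"
      using assms by (simp add: card_gt_0_iff finite_colorings colorings_nonempty)
    ultimately show ?thesis
      using assms by (simp add: measure_pmf_of_set finite_colorings colorings_nonempty field_simps)
  qed
  have collisions: "{\<kappa>. \<not> inj_on \<kappa> W} = (\<Union>p\<in>?D. {\<kappa>. \<kappa> (fst p) = \<kappa> (snd p)})"
    by (auto simp: inj_on_def) blast
  have "measure_pmf.prob (pmf_of_set ?C) {\<kappa>. \<not> inj_on \<kappa> W}
      \<le> (\<Sum>p\<in>?D. measure_pmf.prob (pmf_of_set ?C) {\<kappa>. \<kappa> (fst p) = \<kappa> (snd p)})"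
    unfolding collisions by (rule measure_pmf.finite_measure_subadditive_finite[OF finD]) simp
  also have "\<dots> \<le> (\<Sum>p\<in>?D. 1 / m)"
    by (rule sum_mono) (rule pair)
  also have "\<dots> = card ?D * (1 / m)"
    by simp
  also have "\<dots> \<le> (card W)\<^sup>2 * (1 / m)"
  proof -
    have "card ?D \<le> (card W)\<^sup>2"
      using card_mono[OF _ D] W by (simp add: card_cartesian_product power2_eq_square)
    then have "real (card ?D) \<le> real ((card W)\<^sup>2)"
      by (rule of_nat_mono)
    then show ?thesis
      by (intro mult_right_mono) auto
  qed
  finally show ?thesis
    by simp
qed


section \<open>Packings from a single round\<close>

lemma is_packing_mono: "is_packing X k M \<Longrightarrow> X \<subseteq> F \<Longrightarrow> is_packing F k M"
  by (auto simp: is_packing_def)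

lemma length_color_queries: "length (color_queries d m U \<kappa>) \<le> m ^ d"
  unfolding color_queries_def
  by (rule order_trans[OF length_filter_le]) (simp add: length_n_lists)

lemma gpise_query_color_queries: "Q \<in> set (color_queries d m U \<kappa>) \<Longrightarrow> gpise_query d U Q"
  by (simp add: color_queries_def)

text \<open>List the vertices of \<open>e\<close> in any order and query their colour classes.
  Injectivity on \<open>e\<close> makes the classes disjoint, so the query survives the filter. A
  set crossing it has one vertex in each of these classes and none elsewhere, hence the colours of
  \<open>e\<close>.\<close>

lemma ex_color_query:
  assumes "finite U" "e \<subseteq> U" "card e = d" "inj_on \<kappa> e" "\<kappa> ` e \<subseteq> {..<m}"
  shows "\<exists>Q\<in>set (color_queries d m U \<kappa>). crosses e Q
    \<and> (\<forall>e'. crosses e' Q \<longrightarrow> \<kappa> ` e' = \<kappa> ` e)"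
proof -
  have "finite e"
    using assms finite_subset by blast
  then obtain us where us: "set us = e" "distinct us"
    using finite_distinct_list by blast
  have len: "length us = d"
    using us assms distinct_card by metis
  let ?Q = "map (\<lambda>c. {u \<in> U. \<kappa> u = c}) (map \<kappa> us)"
  have us_mem: "us ! i \<in> e" if "i < d" for i
    using that us len nth_mem by metis
  have neq: "\<kappa> (us ! i) \<noteq> \<kappa> (us ! j)" if "i < d" "j < d" "i \<noteq> j" for i j
    using that us_mem assms(4) us(2) len by (metis inj_on_eq_iff nth_eq_iff_index_eq)
  have "gpise_query d U ?Q"
    unfolding gpise_query_def using us_mem assms(2) neq by (auto simp: len)
  moreover have "map \<kappa> us \<in> set (List.n_lists d [0..<m])"
    using assms(5) us len by (auto simp: set_n_lists)
  ultimately have "?Q \<in> set (color_queries d m U \<kappa>)"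
    unfolding color_queries_def by (simp del: map_map)
  moreover have "crosses e ?Q"
    unfolding crosses_def using us us_mem assms(2) len by (intro exI[of _ us]) auto
  moreover have "\<kappa> ` e' = \<kappa> ` e" if cr: "crosses e' ?Q" for e'
  proof -
    obtain vs where vs: "length vs = d" "e' = set vs" "\<forall>i<d. \<kappa> (vs ! i) = \<kappa> (us ! i)"
      using cr len by (auto simp: crosses_def)
    then have "map \<kappa> vs = map \<kappa> us"
      using len by (intro nth_equalityI) auto
    then show ?thesis
      using vs(2) us(1) by (metis list.set_map)
  qed
  ultimately show ?thesis
    by blast
qed

lemma ex_packing_of_answers:
  assumes U: "uniform_hypergraph d U F" and P: "is_packing F k P"
    and inj: "inj_on \<kappa> (\<Union>P)" and \<kappa>: "\<kappa> ` U \<subseteq> {..<m}"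
    and R: "\<And>Q e. Q \<in> set (color_queries d m U \<kappa>) \<Longrightarrow> e \<in> F \<Longrightarrow> crosses e Q
      \<Longrightarrow> \<exists>e'\<in>R. crosses e' Q"
  shows "\<exists>M. is_packing R k M"
proof -
  have "\<exists>e'\<in>R. \<kappa> ` e' = \<kappa> ` e" if "e \<in> P" for e
  proof -
    have e: "e \<in> F" "e \<subseteq> U" "card e = d" "finite U"
      using that U P by (auto simp: uniform_hypergraph_def is_packing_def)
    have "inj_on \<kappa> e"
      by (rule inj_on_subset[OF inj Union_upper[OF that]])
    moreover have "\<kappa> ` e \<subseteq> {..<m}"
      using \<kappa> e(2) by blast
    ultimately obtain Q where Q: "Q \<in> set (color_queries d m U \<kappa>)" "crosses e Q"
      "\<forall>e'. crosses e' Q \<longrightarrow> \<kappa> ` e' = \<kappa> ` e"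
      using ex_color_query[OF e(4,2,3)] by blast
    obtain e' where "e' \<in> R" "crosses e' Q"
      using R[OF Q(1) e(1) Q(2)] by blast
    then show ?thesis
      using Q(3) by blast
  qed
  \<comment> \<open>\<open>h\<close> trades each hyperedge of the unknown packing for an answer with
    the same colour set.\<close>
  then obtain h where h: "\<And>e. e \<in> P \<Longrightarrow> h e \<in> R \<and> \<kappa> ` h e = \<kappa> ` e"
    by metis
  \<comment> \<open>\<open>h e\<close> determines the colours of \<open>e\<close>, and these
    determine \<open>e\<close> since \<kappa> is injective on all vertices of the packing. Hence the
    image of \<open>P\<close> still has at least \<open>k\<close> members.\<close>
  have "inj_on h P"
  proof (rule inj_onI)
    fix e e' assume e: "e \<in> P" "e' \<in> P" and "h e = h e'"
    then have "\<kappa> ` e = \<kappa> ` e'"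
      using h by metis
    then show "e = e'"
      using inj_on_image_eq_iff[OF inj Union_upper[OF e(1)] Union_upper[OF e(2)]] by simp
  qed
  moreover have "disjnt (h e) (h e')" if "e \<in> P" "e' \<in> P" "e \<noteq> e'" for e e'
  proof -
    have "disjnt e e'"
      using that P by (auto simp: is_packing_def pairwise_def)
    then have "\<kappa> ` e \<inter> \<kappa> ` e' = {}"
      using inj_on_image_Int[OF inj, of e e'] that by (auto simp: disjnt_def)
    then have "\<kappa> ` h e \<inter> \<kappa> ` h e' = {}"
      using h[OF that(1)] h[OF that(2)] by simp
    then show ?thesis
      by (auto simp: disjnt_def)
  qed
  ultimately have "is_packing R k (h ` P)"
    using h P by (auto simp: is_packing_def card_image pairwise_def)
  then show ?thesis ..
qed

text \<open>\<open>is_packing\<close> bounds the size only from below; trimming to exactly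
  \<open>k\<close> hyperedges is what limits the vertices to be separated to
  \<open>d * k\<close>.\<close>

lemma ex_small_packing:
  assumes "is_packing F k M"
  obtains P where "is_packing F k P" "card P = k"
proof -
  obtain P where "P \<subseteq> M" "card P = k" "finite P"
    using assms obtain_subset_with_card_n by (metis is_packing_def)
  then have "is_packing F k P"
    using assms by (auto simp: is_packing_def intro: pairwise_subset)
  then show thesis
    using that \<open>card P = k\<close> by blast
qed

lemma card_Union_packing_le:
  assumes "uniform_hypergraph d U F" "is_packing F k P"
  shows "card (\<Union>P) \<le> card P * d"
proof -
  have "card (\<Union>P) \<le> (\<Sum>e\<in>P. card e)"
    by (rule card_Union_le_sum_card)
  also have "\<dots> = (\<Sum>e\<in>P. d)"
    using assms by (intro sum.cong) (auto simp: is_packing_def uniform_hypergraph_def)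
  finally show ?thesis
    by simp
qed

text \<open>The error is one-sided: a packing found among true hyperedges is always valid, so the
  only possible failure is to have collected too few of them.\<close>

lemma extract_packing_solves:
  assumes "X \<subseteq> F" "(\<exists>M. is_packing F k M) \<Longrightarrow> (\<exists>M. is_packing X k M)"
  shows "solves_packing F k (extract_packing k X)"
proof (cases "\<exists>M. is_packing X k M")
  case True
  then have "is_packing X k (SOME M. is_packing X k M)"
    by (rule someI_ex)
  with True assms show ?thesis
    by (auto simp: solves_packing_def extract_packing_def dest: is_packing_mono)
next
  case False
  with assms show ?thesis
    by (auto simp: solves_packing_def extract_packing_def)
qed


section \<open>Running the algorithm\<close>

text \<open>A batch involves no randomness, so running it amounts to running the continuation on
  enlarged data. Answers may depend on the transcript; therefore only the queries in
  \<open>tr'\<close> and the oracle's guarantee on \<open>R\<close> are recorded, and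
  \<open>X\<close> and \<open>tr\<close> vary in the induction.\<close>

lemma run_query_all:
  assumes "gpise_oracle d U F orc" "\<And>Q. Q \<in> set Qs \<Longrightarrow> gpise_query d U Q"
  shows "\<exists>R tr'. run orc (query_all Qs X g) tr = run orc (g (X \<union> R)) tr'
    \<and> map fst tr' = map fst tr @ Qs \<and> R \<subseteq> F
    \<and> (\<forall>Q\<in>set Qs. \<forall>e\<in>F. crosses e Q \<longrightarrow> (\<exists>e'\<in>R. crosses e' Q))"
  using assms(2)
proof (induction Qs arbitrary: X tr)
  case Nil
  show ?case
    by (intro exI[of _ "{}"] exI[of _ tr]) simp
next
  case (Cons Q Qs)
  let ?r = "orc tr Q"
  have ans: "case ?r of Some e \<Rightarrow> e \<in> F \<and> crosses e Q | None \<Rightarrow> \<not> (\<exists>e\<in>F. crosses e Q)"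
    using assms(1) Cons.prems[of Q] by (simp add: gpise_oracle_def)
  obtain R tr' where "run orc (query_all Qs (X \<union> set_option ?r) g) (tr @ [(Q, ?r)])
        = run orc (g (X \<union> set_option ?r \<union> R)) tr'"
      "map fst tr' = map fst (tr @ [(Q, ?r)]) @ Qs" "R \<subseteq> F"
      "\<forall>Q\<in>set Qs. \<forall>e\<in>F. crosses e Q \<longrightarrow> (\<exists>e'\<in>R. crosses e' Q)"
    using Cons.IH[of "X \<union> set_option ?r" "tr @ [(Q, ?r)]"] Cons.prems by auto
  then show ?case
    using ans
    \<comment> \<open>The answer to \<open>Q\<close> joins those to the remaining queries; if it is
      \<open>None\<close>, no hyperedge crosses \<open>Q\<close>.\<close>
    by (intro exI[of _ "set_option ?r \<union> R"] exI[of _ tr'])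
       (auto simp: Un_assoc split: option.splits)
qed

text \<open>Each round appends at most \<open>m ^ d\<close> queries, all well-formed by the filter.
  The bound holds on every computation path, not just on average.\<close>

lemma run_packing_rounds_transcript:
  assumes "gpise_oracle d U F orc"
    and "(out, tr') \<in> set_pmf (run orc (packing_rounds d m k U t X) tr)"
  shows "length tr' \<le> length tr + t * m ^ d"
    and "fst ` set tr' \<subseteq> fst ` set tr \<union> Collect (gpise_query d U)"
proof -
  have "length tr' \<le> length tr + t * m ^ d \<and>
      fst ` set tr' \<subseteq> fst ` set tr \<union> Collect (gpise_query d U)"
    using assms(2)
  proof (induction t arbitrary: X tr)
    case 0
    then show ?case by auto
  next
    case (Suc t)
    then obtain i where i: "(out, tr') \<in> set_pmf (run orc (query_all
        (color_queries d m U (from_nat_into (colorings m U) i)) X (packing_rounds d m k U t)) tr)"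
      by auto
    let ?Qs = "color_queries d m U (from_nat_into (colorings m U) i)"
    obtain R tr1 where tr1: "run orc (query_all ?Qs X (packing_rounds d m k U t)) tr
        = run orc (packing_rounds d m k U t (X \<union> R)) tr1" "map fst tr1 = map fst tr @ ?Qs"
      using run_query_all[OF assms(1) gpise_query_color_queries[where m = m
        and \<kappa> = "from_nat_into (colorings m U) i"],
        where X = X and tr = tr and g = "packing_rounds d m k U t"] by blast
    have "length tr1 = length tr + length ?Qs"
      using arg_cong[OF tr1(2), of length] by simp
    moreover have "fst ` set tr1 = fst ` set tr \<union> set ?Qs"
      using arg_cong[OF tr1(2), of set] by simp
    moreover note Suc.IH[of "X \<union> R" tr1] i[unfolded tr1(1)]
      length_color_queries[of d m U "from_nat_into (colorings m U) i"]
    ultimately show ?case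
      using gpise_query_color_queries[of _ d m U "from_nat_into (colorings m U) i"] by auto
  qed
  then show "length tr' \<le> length tr + t * m ^ d"
    and "fst ` set tr' \<subseteq> fst ` set tr \<union> Collect (gpise_query d U)"
    by auto
qed

text \<open>The implication from \<open>F\<close> to \<open>X\<close> is an invariant: further
  rounds only enlarge \<open>X\<close>, so once it holds, every path ends with a correct
  output.\<close>

lemma run_packing_rounds_solves:
  assumes "gpise_oracle d U F orc" "X \<subseteq> F"
    and "(\<exists>M. is_packing F k M) \<Longrightarrow> (\<exists>M. is_packing X k M)"
    and "(out, tr') \<in> set_pmf (run orc (packing_rounds d m k U t X) tr)"
  shows "solves_packing F k out"
  using assms(2-)
proof (induction t arbitrary: X tr)
  case 0
  then show ?case
    by (simp add: extract_packing_solves)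
next
  case (Suc t)
  then obtain i where i: "(out, tr') \<in> set_pmf (run orc (query_all
      (color_queries d m U (from_nat_into (colorings m U) i)) X (packing_rounds d m k U t)) tr)"
    by auto
  obtain R tr1 where "run orc (query_all
        (color_queries d m U (from_nat_into (colorings m U) i)) X (packing_rounds d m k U t)) tr
      = run orc (packing_rounds d m k U t (X \<union> R)) tr1" "R \<subseteq> F"
    using run_query_all[OF assms(1) gpise_query_color_queries[where m = m
        and \<kappa> = "from_nat_into (colorings m U) i"],
      where X = X and tr = tr and g = "packing_rounds d m k U t"] by blast
  moreover have "\<exists>M. is_packing (X \<union> R) k M" if "\<exists>M. is_packing F k M"
    using Suc.prems(2)[OF that] is_packing_mono by blast
  ultimately show ?case
    using Suc.IH[of "X \<union> R" tr1] Suc.prems(1) i by simp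
qed

text \<open>Serves both after a lucky round and, with the implication vacuous, for hypergraphs
  without a packing of size \<open>k\<close>.\<close>

corollary run_packing_rounds_no_failure:
  assumes "gpise_oracle d U F orc" "X \<subseteq> F"
    and "(\<exists>M. is_packing F k M) \<Longrightarrow> (\<exists>M. is_packing X k M)"
  shows "measure_pmf.prob (run orc (packing_rounds d m k U t X) tr)
    {(out, tr'). \<not> solves_packing F k out} = 0"
proof -
  have "solves_packing F k out"
    if "(out, tr') \<in> set_pmf (run orc (packing_rounds d m k U t X) tr)" for out tr'
    using run_packing_rounds_solves[OF assms(1,2) _ that] assms(3) by blast
  then show ?thesis
    by (auto simp: measure_pmf_zero_iff)
qed

section \<open>Failure probability over all rounds\<close>

text \<open>Conditioning on the first draw: the indicator makes failure impossible outside the bad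
  set \<open>B\<close>, and within \<open>B\<close> it has probability at most
  \<open>c\<close>.\<close>

lemma measure_bind_pmf_le:
  assumes "\<And>x. x \<in> set_pmf p \<Longrightarrow> measure_pmf.prob (f x) A \<le> c * indicator B x"
  shows "measure_pmf.prob (bind_pmf p f) A \<le> c * measure_pmf.prob p B"
proof -
  have "measure_pmf.prob (bind_pmf p f) A = measure_pmf.expectation p (\<lambda>x. measure_pmf.prob (f x) A)"
    by (auto simp: measure_pmf_bind measure_pmf.measure_bind[where N = "count_space UNIV"]
        measure_subprob)
  also have "\<dots> \<le> measure_pmf.expectation p (\<lambda>x. c * indicator B x)"
  proof (rule integral_mono_AE)
    show "integrable p (\<lambda>x. measure_pmf.prob (f x) A)"
      by (rule measure_pmf.integrable_const_bound[where B = 1]) auto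
    show "integrable p (\<lambda>x. c * indicator B x)"
      by (rule measure_pmf.integrable_const_bound[where B = "\<bar>c\<bar>"])
        (auto simp: indicator_def)
    show "AE x in p. measure_pmf.prob (f x) A \<le> c * indicator B x"
      using assms by (simp add: AE_measure_pmf_iff)
  qed
  finally show ?thesis
    by simp
qed

text \<open>Induction over the rounds, for arbitrary \<open>X\<close> and \<open>tr\<close>, so that
  the bound holds whatever the earlier rounds did. A round whose colouring separates the vertices of
  a fixed packing rules out failure; any other occurs with probability at most 1/2 and leaves
  \<open>(1 / 2) ^ t\<close> for the rest.\<close>

lemma run_packing_rounds_failure:
  assumes H: "uniform_hypergraph d U F" and orc: "gpise_oracle d U F orc"
    and m: "m \<ge> 2 * (d * k)\<^sup>2" "m > 0"
    and M: "is_packing F k M" and "X \<subseteq> F"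
  shows "measure_pmf.prob (run orc (packing_rounds d m k U t X) tr)
    {(out, tr'). \<not> solves_packing F k out} \<le> (1 / 2) ^ t"
  using \<open>X \<subseteq> F\<close>
proof (induction t arbitrary: X tr)
  case 0
  then show ?case by simp
next
  case (Suc t)
  let ?C = "colorings m U"
  let ?A = "{(out, tr'). \<not> solves_packing F k out}"
  obtain P where P: "is_packing F k P" "card P = k"
    using ex_small_packing[OF M] .
  let ?B = "{i. \<not> inj_on (from_nat_into ?C i) (\<Union>P)}"
  have U: "finite U" and PU: "\<Union>P \<subseteq> U"
    using H P(1) by (auto simp: uniform_hypergraph_def is_packing_def)
  have "measure_pmf.prob (run orc (query_all (color_queries d m U (from_nat_into ?C i)) X
      (packing_rounds d m k U t)) tr) ?A \<le> (1 / 2) ^ t * indicator ?B i" for i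
  proof -
    let ?\<kappa> = "from_nat_into ?C i"
    let ?Qs = "color_queries d m U ?\<kappa>"
    obtain R tr1 where R: "run orc (query_all ?Qs X (packing_rounds d m k U t)) tr
        = run orc (packing_rounds d m k U t (X \<union> R)) tr1" "R \<subseteq> F"
        "\<forall>Q\<in>set ?Qs. \<forall>e\<in>F. crosses e Q \<longrightarrow> (\<exists>e'\<in>R. crosses e' Q)"
      using run_query_all[OF orc gpise_query_color_queries[where m = m
        and \<kappa> = "from_nat_into (colorings m U) i"],
        where X = X and tr = tr and g = "packing_rounds d m k U t"] by blast
    show ?thesis
    proof (cases "i \<in> ?B")
      case True
      then show ?thesis
        using Suc.IH[of "X \<union> R" tr1] Suc.prems R by simp
    next
      case False
      have "?\<kappa> \<in> ?C"
        using colorings_nonempty[OF m(2)] by (rule from_nat_into)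
      then have "?\<kappa> ` U \<subseteq> {..<m}"
        by (auto simp: colorings_def)
      then have "\<exists>M. is_packing (X \<union> R) k M"
        using ex_packing_of_answers[OF H P(1), of ?\<kappa> m R] False R(3)
        by (auto dest: is_packing_mono[where F = "X \<union> R"])
      then have "measure_pmf.prob (run orc (packing_rounds d m k U t (X \<union> R)) tr1) ?A = 0"
        using Suc.prems R(2) by (intro run_packing_rounds_no_failure[OF orc]) auto
      then show ?thesis
        using R(1) False by simp
    qed
  qed
  then have "measure_pmf.prob (run orc (packing_rounds d m k U (Suc t) X) tr) ?A
      \<le> (1 / 2) ^ t * measure_pmf.prob (pmf_of_set {0..card ?C - 1}) ?B"
    by (simp add: measure_bind_pmf_le)
  \<comment> \<open>Passage from a uniform index to a uniform colouring.\<close>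
  also have "measure_pmf.prob (pmf_of_set {0..card ?C - 1}) ?B
      = measure_pmf.prob (pmf_of_set ?C) {\<kappa>. \<not> inj_on \<kappa> (\<Union>P)}"
    using map_from_nat_into_pmf_of_set[OF finite_colorings[OF U] colorings_nonempty[OF m(2)],
        symmetric]
    by (simp add: vimage_def)
  also have "\<dots> \<le> (card (\<Union>P))\<^sup>2 / m"
    by (rule prob_coloring_not_inj[OF U PU m(2)])
  \<comment> \<open>The factor 2 in the number of colours is chosen for this bound.\<close>
  also have "\<dots> \<le> 1 / 2"
  proof -
    have "card (\<Union>P) \<le> d * k"
      using card_Union_packing_le[OF H P(1)] P(2) by (simp add: mult.commute)
    then have "2 * (card (\<Union>P))\<^sup>2 \<le> m"
      using m(1) by (meson mult_le_mono2 order_trans power_mono zero_le)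
    then have "real (2 * (card (\<Union>P))\<^sup>2) \<le> real m"
      by (rule of_nat_mono)
    then show ?thesis
      using m(2) by (simp add: field_simps)
  qed
  finally show ?case
    by (simp add: mult_left_mono)
qed

section \<open>Number of rounds and growth of the query count\<close>

lemma power_half_log_le:
  assumes "k \<ge> 1"
  shows "(1 / 2) ^ nat \<lceil>log 2 (real k)\<rceil> \<le> 1 / real k"
proof -
  have "real k = 2 powr log 2 (real k)"
    using assms by simp
  also have "\<dots> \<le> 2 powr real (nat \<lceil>log 2 (real k)\<rceil>)"
    by (intro powr_mono real_nat_ceiling_ge) auto
  also have "\<dots> = 2 ^ nat \<lceil>log 2 (real k)\<rceil>"
    by (simp add: powr_realpow)
  finally show ?thesis
    using assms by (simp add: power_one_over frac_le)
qed

lemma query_bound_bigo: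
  "(\<lambda>k. real (nat \<lceil>log 2 (real k)\<rceil> * (2 * (d * k)\<^sup>2) ^ d))
     \<in> O(\<lambda>k. real k ^ (2 * d) * ln (real k))"
proof (rule bigoI)
  show "\<forall>\<^sub>F k in sequentially. norm (real (nat \<lceil>log 2 (real k)\<rceil> * (2 * (d * k)\<^sup>2) ^ d))
      \<le> (2 / ln 2 * real (2 * d\<^sup>2) ^ d) * norm (real k ^ (2 * d) * ln (real k))"
    using eventually_ge_at_top[of 2]
  proof eventually_elim
    case (elim k)
    \<comment> \<open>From here on, rounding the logarithm up at most doubles it; this is the 2 in
      the constant \<open>2 / ln 2\<close>, while \<open>(2 * d\<^sup>2) ^ d\<close> comes from the
      number of colours.\<close>
    have "log 2 (real k) \<ge> 1"
      using elim by (simp add: le_log_iff)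
    then have "real (nat \<lceil>log 2 (real k)\<rceil>) \<le> 2 * log 2 (real k)"
      by linarith
    also have "\<dots> = 2 / ln 2 * ln (real k)"
      by (simp add: log_def)
    finally have "real (nat \<lceil>log 2 (real k)\<rceil>) * (real (2 * d\<^sup>2) ^ d * real k ^ (2 * d))
        \<le> 2 / ln 2 * ln (real k) * (real (2 * d\<^sup>2) ^ d * real k ^ (2 * d))"
      by (rule mult_right_mono) simp
    moreover have "norm (real (nat \<lceil>log 2 (real k)\<rceil> * (2 * (d * k)\<^sup>2) ^ d))
        = real (nat \<lceil>log 2 (real k)\<rceil>) * (real (2 * d\<^sup>2) ^ d * real k ^ (2 * d))"
      by (simp add: power_mult_distrib power_mult)
    moreover have "norm (real k ^ (2 * d) * ln (real k)) = real k ^ (2 * d) * ln (real k)"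
      using elim by simp
    ultimately show ?case
      by (simp only: mult_ac)
  qed
qed

theorem theorem1:
  fixes d :: nat
  assumes "d \<ge> 2"
  shows "\<exists>(alg :: 'a set \<Rightarrow> nat \<Rightarrow> ('a set list, 'a set option, 'a set set option) rand_alg)
           (q :: nat \<Rightarrow> nat) (c :: real).
    c > 0 \<and>
    (\<lambda>k. real (q k)) \<in> O(\<lambda>k. real k ^ (2 * d) * ln (real k)) \<and>
    (\<forall>U F k orc.
       uniform_hypergraph d U F \<and> k \<ge> 1 \<and> gpise_oracle d U F orc \<longrightarrow>
         (\<forall>(out, tr) \<in> set_pmf (run orc (alg U k) []).
            length tr \<le> q k \<and> (\<forall>(As, r) \<in> set tr. gpise_query d U As)) \<and>
         measure_pmf.prob (run orc (alg U k) []) {(out, tr). solves_packing F k out}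
           \<ge> 1 - 1 / real k powr c)"
proof (intro exI conjI allI impI; (elim conjE)?)
  let ?m = "\<lambda>k. 2 * (d * k)\<^sup>2"
  let ?t = "\<lambda>k. nat \<lceil>log 2 (real k)\<rceil>"
  let ?alg = "\<lambda>(U :: 'a set) k. packing_rounds d (?m k) k U (?t k) {}"
  let ?q = "\<lambda>k. ?t k * ?m k ^ d"
  \<comment> \<open>The exponent is \<open>c = 1\<close>, as the number of rounds brings the failure
    probability down to \<open>1 / k\<close>.\<close>
  show "(1 :: real) > 0"
    by simp
  show "(\<lambda>k. real (?q k)) \<in> O(\<lambda>k. real k ^ (2 * d) * ln (real k))"
    by (rule query_bound_bigo)
  fix U :: "'a set" and F and k :: nat and orc
  assume H: "uniform_hypergraph d U F" and k: "k \<ge> 1" and orc: "gpise_oracle d U F orc"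
  show "\<forall>(out, tr) \<in> set_pmf (run orc (?alg U k) []).
      length tr \<le> ?q k \<and> (\<forall>(As, r) \<in> set tr. gpise_query d U As)"
  proof safe
    fix out tr As r
    assume run: "(out, tr) \<in> set_pmf (run orc (?alg U k) [])"
    show "length tr \<le> ?q k"
      using run_packing_rounds_transcript(1)[OF orc run] by simp
    assume "(As, r) \<in> set tr"
    then show "gpise_query d U As"
      using run_packing_rounds_transcript(2)[OF orc run] by force
  qed
  have "measure_pmf.prob (run orc (?alg U k) []) {(out, tr). \<not> solves_packing F k out}
      \<le> (1 / 2) ^ ?t k"
  proof (cases "\<exists>M. is_packing F k M")
    case True
    then show ?thesis
      using run_packing_rounds_failure[OF H orc] k assms by auto
  next
    case False
    then have "measure_pmf.prob (run orc (?alg U k) []) {(out, tr). \<not> solves_packing F k out} = 0"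
      by (intro run_packing_rounds_no_failure[OF orc]) auto
    then show ?thesis
      by simp
  qed
  also have "\<dots> \<le> 1 / real k powr 1"
    using power_half_log_le[OF k] k by simp
  also have "{(out, tr). \<not> solves_packing F k out}
      = UNIV - {(out :: 'a set set option, tr). solves_packing F k out}"
    by auto
  finally show "measure_pmf.prob (run orc (?alg U k) []) {(out, tr). solves_packing F k out}
      \<ge> 1 - 1 / real k powr 1"
    using measure_pmf.prob_compl[of "{(out, tr). solves_packing F k out}" "run orc (?alg U k) []"]
    by simp
qed

end
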